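(* Let $\Gamma\in[1-2^{-12},1[$ and let $f_\Gamma$ be the function constructed in the context. Let $$\mathcal D_\Gamma=\{(x,v)\in\mathbb R^3\times\mathbb R^3: -1\le |x\wedge v|^2-|x|^2-|v|^2\le 0,\ |x\wedge v|^2\le\Gamma\},$$ $$\mathcal M_\Gamma=\{(x,v)\in\mathbb R^3\times\mathbb R^3: |x|^2+|v|^2-|x\wedge v|^2=1,\ |x\wedge v|^2\le\Gamma\}\subset\mathcal D_\Gamma,$$ $$\mathcal N_\Gamma=\{(x,v)\in\mathbb R^3\times\mathbb R^3: |x|^2+|v|^2-|x\wedge v|^2=\Gamma,\ |x\wedge v|^2\le\Gamma\}\subset\mathcal D_\Gamma.$$ Then $f_\Gamma$ is continuous and positive on $\mathcal D_\Gamma\setminus(\mathcal M_\Gamma\cup\mathcal N_\Gamma)$. Moreover, there exists $l_\Gamma>0$ such that $$f_\Gamma(x,v)\to l_\Gamma\quad\text{as}\quad (x,v)\searrow\mathcal N_\Gamma,$$ and furthermore $$f_\Gamma(x,v)\to\infty\quad\text{as}\quad (x,v)\nearrow\mathcal N_\Gamma\ \text{ or }\ (x,v)\nearrow\mathcal M_\Gamma.$$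
   Context: $x\wedge v$ is the cross product in $\mathbb R^3$; $]a,b]$, $[a,b[$ denote half-open intervals. Notation for one-sided limits: $(x,v)\searrow\mathcal N_\Gamma$ means $(x,v)\in\mathcal D_\Gamma$, $|x|^2+|v|^2-|x\wedge v|^2>\Gamma$, and $\mathrm{dist}((x,v),\mathcal N_\Gamma)\to0$. Similarly $(x,v)\nearrow\mathcal N_\Gamma$ means $(x,v)\in\mathcal D_\Gamma$, $|x|^2+|v|^2-|x\wedge v|^2<\Gamma$, $\mathrm{dist}((x,v),\mathcal N_\Gamma)\to0$; and $(x,v)\nearrow\mathcal M_\Gamma$ means $(x,v)\in\mathcal D_\Gamma$, $|x|^2+|v|^2-|x\wedge v|^2<1$, $\mathrm{dist}((x,v),\mathcal M_\Gamma)\to0$. Construction of $f_\Gamma$ for $\Gamma\in[1-2^{-12},1[$: let $R=2(1-\Gamma)^{1/3}$ and $h_c(z)=z\big(1-\frac{\Gamma}{1-z}\big)$ for $z\in\mathbb C$, $|z|\le R$ (it maps this disc into itself), with iterates $h_c^0(z)=z$, $h_c^k=h_c\circ h_c^{k-1}$. Let $\tilde\psi(z)=\sum_{k=0}^\infty h_c^k(z)$ for $|z|<R$ (a holomorphic function), and let $\psi(s)=\tilde\psi(s)$ for $s\in[0,1-\Gamma]$, $\psi(s)=s$ for $s\in[1-\Gamma,1]$. Let $\varphi=\varphi_\Gamma:[0,1]\to\mathbb R$ be given by $\varphi(0)=0$ and $\varphi(s)=\frac1{\pi^2}\frac{d}{ds}\int_0^s\frac{\psi(s-\sigma)}{\sqrt\sigma}\,d\sigma$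 for $s\in]0,1]$; it is $C^\infty$ on $]0,1-\Gamma[$ and on $]1-\Gamma,1]$. Finally, with $s(x,v)=1+|x\wedge v|^2-|x|^2-|v|^2$, $$f_\Gamma(x,v)=\frac{3}{4\pi}\,\varphi'(s(x,v))\quad\text{if } |x\wedge v|^2\le\Gamma\text{ and } s(x,v)\in]0,1]\setminus\{1-\Gamma\},$$ and $f_\Gamma(x,v)=0$ otherwise. *)

theory Defs
  imports "HOL-Analysis.Analysis"
begin

type_synonym phase = "(real^3) \<times> (real^3)"

definition h_c :: "real \<Rightarrow> complex \<Rightarrow> complex" where
  "h_c \<Gamma> z = z * (1 - of_real \<Gamma> / (1 - z))"

(* Meaningful for |z| < R = 2 * (1 - \<Gamma>) powr (1/3), where the series converges. It is only used
   at the real points of {0..1-\<Gamma>}, which lie in that disc. *)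
definition psi_tilde :: "real \<Rightarrow> complex \<Rightarrow> complex" where
  "psi_tilde \<Gamma> z = (\<Sum>k. (h_c \<Gamma> ^^ k) z)"

(* Only the values on {0..1} matter. The terms of the series are real for real s, so Re merely
   changes the type. At s = 1-\<Gamma> the two branches agree because h_c \<Gamma> (1-\<Gamma>) = 0 = h_c \<Gamma> 0. *)
definition psi :: "real \<Rightarrow> real \<Rightarrow> real" where
  "psi \<Gamma> s = (if s \<le> 1 - \<Gamma> then Re (psi_tilde \<Gamma> (of_real s)) else s)"

(* psi and phi live on {0..1}, so derivatives are taken within {0..1}: two-sided in the interior,
   the left derivative at 1. The last point is needed because s_fun (0, 0) = 1.
   The integrand's value 0 at \<sigma> = 0 (division by zero) does not affect the integral. *)
definition phi :: "real \<Rightarrow> real \<Rightarrow> real" where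
  "phi \<Gamma> s = (if s = 0 then 0 else
     1 / pi\<^sup>2 * vector_derivative
       (\<lambda>t. integral {0..t} (\<lambda>\<sigma>. psi \<Gamma> (t - \<sigma>) / sqrt \<sigma>)) (at s within {0..1}))"

definition phi' :: "real \<Rightarrow> real \<Rightarrow> real" where
  "phi' \<Gamma> s = vector_derivative (phi \<Gamma>) (at s within {0..1})"

definition q_fun :: "phase \<Rightarrow> real" where
  "q_fun = (\<lambda>(x, v). (norm x)\<^sup>2 + (norm v)\<^sup>2 - (norm (cross3 x v))\<^sup>2)"

definition s_fun :: "phase \<Rightarrow> real" where
  "s_fun = (\<lambda>(x, v). 1 + (norm (cross3 x v))\<^sup>2 - (norm x)\<^sup>2 - (norm v)\<^sup>2)"

definition f_Gamma :: "real \<Rightarrow> phase \<Rightarrow> real" where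
  "f_Gamma \<Gamma> = (\<lambda>(x, v).
     if (norm (cross3 x v))\<^sup>2 \<le> \<Gamma> \<and> s_fun (x, v) \<in> {0<..1} - {1 - \<Gamma>}
     then 3 / (4 * pi) * phi' \<Gamma> (s_fun (x, v)) else 0)"

definition D_set :: "real \<Rightarrow> phase set" where
  "D_set \<Gamma> = {(x, v).
     -1 \<le> (norm (cross3 x v))\<^sup>2 - (norm x)\<^sup>2 - (norm v)\<^sup>2 \<and>
     (norm (cross3 x v))\<^sup>2 - (norm x)\<^sup>2 - (norm v)\<^sup>2 \<le> 0 \<and>
     (norm (cross3 x v))\<^sup>2 \<le> \<Gamma>}"

definition M_set :: "real \<Rightarrow> phase set" where
  "M_set \<Gamma> = {(x, v). q_fun (x, v) = 1 \<and> (norm (cross3 x v))\<^sup>2 \<le> \<Gamma>}"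

definition N_set :: "real \<Rightarrow> phase set" where
  "N_set \<Gamma> = {(x, v). q_fun (x, v) = \<Gamma> \<and> (norm (cross3 x v))\<^sup>2 \<le> \<Gamma>}"

lemma M_set_subset_D_set: "M_set \<Gamma> \<subseteq> D_set \<Gamma>"
  by (auto simp: M_set_def D_set_def q_fun_def)

lemma N_set_subset_D_set: "0 \<le> \<Gamma> \<Longrightarrow> \<Gamma> \<le> 1 \<Longrightarrow> N_set \<Gamma> \<subseteq> D_set \<Gamma>"
  by (auto simp: N_set_def D_set_def q_fun_def)

(* The filter "p in S, dist(p, A) -> 0"; on pairs, dist is the Euclidean distance of R^6. *)
definition approaching :: "phase set \<Rightarrow> phase set \<Rightarrow> phase filter" where
  "approaching S A = inf (filtercomap (\<lambda>p. infdist p A) (nhds 0)) (principal S)"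

definition N_down :: "real \<Rightarrow> phase filter" where
  "N_down \<Gamma> = approaching {p \<in> D_set \<Gamma>. q_fun p > \<Gamma>} (N_set \<Gamma>)"

definition N_up :: "real \<Rightarrow> phase filter" where
  "N_up \<Gamma> = approaching {p \<in> D_set \<Gamma>. q_fun p < \<Gamma>} (N_set \<Gamma>)"

definition M_up :: "real \<Rightarrow> phase filter" where
  "M_up \<Gamma> = approaching {p \<in> D_set \<Gamma>. q_fun p < 1} (M_set \<Gamma>)"

end

theory Submission
  imports Defs "HOL-Complex_Analysis.Cauchy_Integral_Formula" "HOL-Real_Asymp.Real_Asymp"
begin

text \<open>Since h_c halves the modulus on the disc of radius 1/4, the series for psi converges there to
  a holomorphic function. Let J(t) be the Abel integral of psi over [0, t]. For t < 1 - \<Gamma> the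
  substitution \<sigma> = t w^2 gives J(t) = 2 sqrt t * (integral of psi(t (1 - w^2)) over w in [0, 1]), so
  J''(t) = psi'(0) / sqrt t up to an error O(sqrt t), which Cauchy's estimate for the second derivative of psi
  keeps below half of the main term. For t > 1 - \<Gamma> one has
  J(t) = 4/3 t^(3/2) + (integral of (psi(u) - u) (t - u)^(-1/2) over u in [0, 1 - \<Gamma>]). This can be
  differentiated twice under the integral sign, and psi(u) - u is nonnegative and vanishes only to first order at
  u = 1 - \<Gamma>, so the resulting kernel (t - u)^(-5/2) makes J'' blow up like (t - (1 - \<Gamma>))^(-1/2).\<close>

section \<open>Holomorphy of the iteration series\<close>

locale gamma_near_one =
  fixes \<Gamma> :: real
  assumes Gamma_ge: "1 - 1 / 2 ^ 12 \<le> \<Gamma>" and Gamma_less: "\<Gamma> < 1"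
begin

lemma h_c_eq: "z \<noteq> 1 \<Longrightarrow> h_c \<Gamma> z = z * (of_real (1 - \<Gamma>) - z) / (1 - z)"
  by (simp add: h_c_def field_simps)

text \<open>In the factored form the numerator factor is at most 1/8 + 1/4 and the denominator at
  least 3/4, so \<open>z\<close> gets multiplied by something of modulus at most 1/2. The radius 1/4
  serves every admissible \<Gamma> and exceeds R, which is at most 1/8.\<close>

lemma norm_h_c_le:
  assumes "norm z \<le> 1 / 4"
  shows "norm (h_c \<Gamma> z) \<le> norm z / 2"
proof -
  have z1: "z \<noteq> 1" using assms by auto
  have 1: "norm (of_real (1 - \<Gamma>) - z) \<le> 3 / 8"
    using norm_triangle_ineq4[of "of_real (1 - \<Gamma>)" z] assms Gamma_ge Gamma_less
    by (simp add: norm_of_real del: of_real_diff)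
  have 2: "norm (1 - z) \<ge> 3 / 4"
    using norm_triangle_ineq2[of 1 z] assms by simp
  have "norm (of_real (1 - \<Gamma>) - z) \<le> (1 / 2) * norm (1 - z)"
    using 1 2 by linarith
  hence "norm z * norm (of_real (1 - \<Gamma>) - z) \<le> norm z * ((1 / 2) * norm (1 - z))"
    by (rule mult_left_mono) simp
  thus ?thesis
    unfolding h_c_eq[OF z1] norm_divide norm_mult using z1
    by (simp add: field_simps)
qed

lemma norm_funpow_h_c_le:
  assumes "norm z \<le> 1 / 4"
  shows "norm ((h_c \<Gamma> ^^ k) z) \<le> (1 / 2) ^ k * (1 / 4)"
proof (induction k)
  case (Suc k)
  have "(1 / 2) ^ k * (1 / 4) \<le> (1 / 4 :: real)" by (simp add: power_le_one)
  with Suc have "norm ((h_c \<Gamma> ^^ k) z) \<le> 1 / 4" by linarith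
  from norm_h_c_le[OF this] Suc show ?case by simp
qed (use assms in simp)

lemma norm_funpow_h_c_le_quarter:
  assumes "norm z \<le> 1 / 4"
  shows "norm ((h_c \<Gamma> ^^ k) z) \<le> 1 / 4"
proof -
  have "(1 / 2) ^ k * (1 / 4) \<le> (1 / 4 :: real)" by (simp add: power_le_one)
  with norm_funpow_h_c_le[OF assms, of k] show ?thesis by linarith
qed

lemma summable_half_powers: "summable (\<lambda>k. (1 / 2) ^ k * (1 / 4 :: real))"
  by (intro summable_mult2 summable_geometric) simp

lemma summable_funpow_h_c: "norm z \<le> 1 / 4 \<Longrightarrow> summable (\<lambda>k. (h_c \<Gamma> ^^ k) z)"
  by (rule summable_comparison_test'[OF summable_half_powers, of 0]) (rule norm_funpow_h_c_le)

lemma norm_psi_tilde_le: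
  assumes "norm z \<le> 1 / 4"
  shows "norm (psi_tilde \<Gamma> z) \<le> 1 / 2"
proof -
  have "norm (psi_tilde \<Gamma> z) \<le> (\<Sum>k. (1 / 2) ^ k * (1 / 4 :: real))"
    unfolding psi_tilde_def
    by (rule norm_suminf_le[OF norm_funpow_h_c_le[OF assms] summable_half_powers])
  also have "\<dots> = 1 / 2"
    by (subst suminf_mult2[symmetric]) (simp_all add: suminf_geometric)
  finally show ?thesis .
qed

lemma holomorphic_funpow_h_c: "(h_c \<Gamma> ^^ k) holomorphic_on ball 0 (1 / 4)"
proof (induction k)
  case (Suc k)
  have "h_c \<Gamma> holomorphic_on cball 0 (1 / 4)"
    unfolding h_c_def by (intro holomorphic_intros) auto
  moreover have "(h_c \<Gamma> ^^ k) ` ball 0 (1 / 4) \<subseteq> cball 0 (1 / 4)"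
    using norm_funpow_h_c_le_quarter by auto
  ultimately show ?case
    unfolding funpow.simps(2) using holomorphic_on_compose_gen[OF Suc] by blast
qed (simp add: id_def)

text \<open>Around each point there is a closed disc inside the open one, and there the geometric
  majorant makes the partial sums converge uniformly. Locally uniform limits of holomorphic
  functions are holomorphic.\<close>

lemma holomorphic_psi_tilde: "psi_tilde \<Gamma> holomorphic_on ball 0 (1 / 4)"
proof (rule holomorphic_uniform_sequence[where f = "\<lambda>n z. \<Sum>k<n. (h_c \<Gamma> ^^ k) z"])
  show "(\<lambda>z. \<Sum>k<n. (h_c \<Gamma> ^^ k) z) holomorphic_on ball 0 (1 / 4)" for n
    by (intro holomorphic_intros holomorphic_funpow_h_c)
next
  fix z :: complex assume "z \<in> ball 0 (1 / 4)"
  then obtain d where d: "d > 0" "cball z d \<subseteq> ball 0 (1 / 4)"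
    by (meson open_ball open_contains_cball)
  have "uniform_limit (cball z d) (\<lambda>n z. \<Sum>k<n. (h_c \<Gamma> ^^ k) z) (psi_tilde \<Gamma>) sequentially"
    unfolding psi_tilde_def
  proof (rule Weierstrass_m_test[OF _ summable_half_powers])
    fix k w assume "w \<in> cball z d"
    hence "norm w \<le> 1 / 4" using d(2) by auto
    thus "norm ((h_c \<Gamma> ^^ k) w) \<le> (1 / 2) ^ k * (1 / 4)" by (rule norm_funpow_h_c_le)
  qed
  with d show "\<exists>d>0. cball z d \<subseteq> ball 0 (1 / 4) \<and>
      uniform_limit (cball z d) (\<lambda>n z. \<Sum>k<n. (h_c \<Gamma> ^^ k) z) (psi_tilde \<Gamma>) sequentially"
    by blast
qed simp

text \<open>Splitting off the term k = 0 leaves the same series started at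
  \<open>h_c \<Gamma> z\<close>. This yields both the derivative at 0 and the lower bound on the
  real segment.\<close>

lemma psi_tilde_functional_eq:
  assumes "norm z \<le> 1 / 4"
  shows "psi_tilde \<Gamma> z = z + psi_tilde \<Gamma> (h_c \<Gamma> z)"
  using suminf_split_head[OF summable_funpow_h_c[OF assms]]
  by (simp add: psi_tilde_def funpow_Suc_right del: funpow.simps(2))

lemma psi_tilde_0: "psi_tilde \<Gamma> 0 = 0"
proof -
  have "(h_c \<Gamma> ^^ k) 0 = 0" for k by (induction k) (simp_all add: h_c_def)
  thus ?thesis by (simp add: psi_tilde_def)
qed

text \<open>The origin is a fixed point of \<open>h_c\<close> with multiplier 1 - \<Gamma>, so
  differentiating the functional equation there gives d = 1 + d (1 - \<Gamma>).\<close>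

lemma deriv_psi_tilde_0: "deriv (psi_tilde \<Gamma>) 0 = of_real (1 / \<Gamma>)"
proof -
  define d where "d = deriv (psi_tilde \<Gamma>) 0"
  have F: "(psi_tilde \<Gamma> has_field_derivative d) (at 0)"
    unfolding d_def by (rule holomorphic_derivI[OF holomorphic_psi_tilde]) auto
  have h: "(h_c \<Gamma> has_field_derivative of_real (1 - \<Gamma>)) (at 0)"
    unfolding h_c_def by (rule derivative_eq_intros refl | simp)+
  have "h_c \<Gamma> 0 = 0" by (simp add: h_c_def)
  have "((\<lambda>z. z + psi_tilde \<Gamma> (h_c \<Gamma> z)) has_field_derivative 1 + d * of_real (1 - \<Gamma>)) (at 0)"
    by (intro DERIV_add DERIV_ident DERIV_chain2[OF _ h]) (simp add: \<open>h_c \<Gamma> 0 = 0\<close> F)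
  hence "(psi_tilde \<Gamma> has_field_derivative 1 + d * of_real (1 - \<Gamma>)) (at 0)"
    by (rule has_field_derivative_transform_within_open[where S = "ball 0 (1 / 4)"])
       (auto simp: psi_tilde_functional_eq[symmetric])
  from DERIV_unique[OF F this] have "d * of_real \<Gamma> = 1"
    by (simp add: algebra_simps)
  moreover have "\<Gamma> \<noteq> 0" using Gamma_ge by auto
  ultimately show ?thesis
    unfolding d_def[symmetric] by (simp add: field_simps)
qed

text \<open>Cauchy's estimate on a circle of radius 1/16, where \<open>psi_tilde\<close> has modulus
  at most 1/2, gives 2 * (1/2) * 16^2 = 256.\<close>

lemma norm_deriv2_psi_tilde_le:
  assumes "norm z \<le> 1 / 16"
  shows "norm (deriv (deriv (psi_tilde \<Gamma>)) z) \<le> 256"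
proof -
  have sub: "cball z (1 / 16) \<subseteq> ball 0 (1 / 4)"
  proof
    fix w assume "w \<in> cball z (1 / 16)"
    thus "w \<in> ball 0 (1 / 4)"
      using assms norm_triangle_ineq4[of z "z - w"] by (simp add: dist_norm)
  qed
  have "norm ((deriv ^^ 2) (psi_tilde \<Gamma>) z) \<le> fact 2 * (1 / 2) / (1 / 16) ^ 2"
  proof (rule Cauchy_inequality)
    show "psi_tilde \<Gamma> holomorphic_on ball z (1 / 16)"
      by (rule holomorphic_on_subset[OF holomorphic_psi_tilde]) (use sub in auto)
    show "continuous_on (cball z (1 / 16)) (psi_tilde \<Gamma>)"
      by (rule continuous_on_subset[OF holomorphic_on_imp_continuous_on[OF holomorphic_psi_tilde] sub])
    fix w assume "norm (z - w) = 1 / 16"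
    hence "w \<in> cball z (1 / 16)" by (simp add: dist_norm)
    hence "w \<in> ball 0 (1 / 4)" using sub by blast
    thus "norm (psi_tilde \<Gamma> w) \<le> 1 / 2" by (intro norm_psi_tilde_le) auto
  qed simp
  thus ?thesis by (simp add: numeral_2_eq_2 fact_numeral)
qed

section \<open>The iteration on the real segment from 0 to 1 - \<Gamma>\<close>

lemma h_c_of_real:
  assumes "u \<in> {0..1 - \<Gamma>}"
  shows "h_c \<Gamma> (of_real u) = of_real (u * (1 - \<Gamma> - u) / (1 - u))"
    and "u * (1 - \<Gamma> - u) / (1 - u) \<in> {0..1 - \<Gamma>}"
proof -
  have u: "0 \<le> u" "u \<le> 1 - \<Gamma>" "u \<le> 1 / 16" using assms Gamma_ge by auto
  have "of_real u \<noteq> (1 :: complex)" using u unfolding of_real_eq_1_iff by simp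
  from h_c_eq[OF this] show "h_c \<Gamma> (of_real u) = of_real (u * (1 - \<Gamma> - u) / (1 - u))"
    by simp
  have "u * (1 - \<Gamma> - u) \<le> (1 - \<Gamma>) * (1 - u)"
    by (rule mult_mono) (use u Gamma_ge in auto)
  thus "u * (1 - \<Gamma> - u) / (1 - u) \<in> {0..1 - \<Gamma>}"
    using u by (auto simp: divide_simps)
qed

text \<open>Invariance of the segment keeps the whole orbit real and nonnegative, and hence every
  term of the series.\<close>

lemma funpow_h_c_of_real:
  assumes "u \<in> {0..1 - \<Gamma>}"
  shows "\<exists>y\<in>{0..1 - \<Gamma>}. (h_c \<Gamma> ^^ k) (of_real u) = of_real y"
proof (induction k)
  case 0 thus ?case using assms by auto
next
  case (Suc k) 
  then obtain y where y: "y \<in> {0..1 - \<Gamma>}" "(h_c \<Gamma> ^^ k) (of_real u) = of_real y" by blast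
  thus ?case using h_c_of_real[OF y(1)] by (metis comp_apply funpow.simps(2))
qed

lemma norm_of_real_le_quarter: "u \<in> {0..1 - \<Gamma>} \<Longrightarrow> norm (of_real u :: complex) \<le> 1 / 4"
  using Gamma_ge by (simp add: norm_of_real)

lemma Re_psi_tilde_nonneg:
  assumes "u \<in> {0..1 - \<Gamma>}"
  shows "0 \<le> Re (psi_tilde \<Gamma> (of_real u))"
proof -
  note summ = summable_funpow_h_c[OF norm_of_real_le_quarter[OF assms]]
  have "0 \<le> Re ((h_c \<Gamma> ^^ k) (of_real u))" for k
    using funpow_h_c_of_real[OF assms, of k] by auto
  thus ?thesis
    unfolding psi_tilde_def Re_suminf[OF summ] by (intro suminf_nonneg summable_Re summ)
qed

text \<open>Two uses of the functional equation isolate the terms k = 0 and k = 1; the remainder is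
  nonnegative. The second term is what lifts \<open>psi\<close> above the identity inside the
  segment.\<close>

lemma Re_psi_tilde_ge:
  assumes "u \<in> {0..1 - \<Gamma>}"
  shows "u + u * (1 - \<Gamma> - u) / (1 - u) \<le> Re (psi_tilde \<Gamma> (of_real u))"
proof -
  define v where "v = u * (1 - \<Gamma> - u) / (1 - u)"
  have v: "h_c \<Gamma> (of_real u) = of_real v" "v \<in> {0..1 - \<Gamma>}"
    using h_c_of_real[OF assms] unfolding v_def by auto
  have "psi_tilde \<Gamma> (of_real u) = of_real u + (of_real v + psi_tilde \<Gamma> (h_c \<Gamma> (of_real v)))"
    using psi_tilde_functional_eq[OF norm_of_real_le_quarter[OF assms]]
      psi_tilde_functional_eq[OF norm_of_real_le_quarter[OF v(2)]] by (simp add: v(1))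
  moreover have "0 \<le> Re (psi_tilde \<Gamma> (h_c \<Gamma> (of_real v)))"
    using Re_psi_tilde_nonneg h_c_of_real[OF v(2)] by metis
  ultimately show ?thesis by (simp add: v_def)
qed

end

lemma has_real_derivative_Re_of_real:
  assumes "(f has_field_derivative d) (at (of_real x))"
  shows "((\<lambda>x. Re (f (of_real x))) has_real_derivative Re d) (at x within S)"
proof -
  have "((\<lambda>x. f (of_real x)) has_vector_derivative d) (at x within S)"
    using has_vector_derivative_real_field[OF assms]
     by (simp add: o_def)
  thus ?thesis
    unfolding has_real_derivative_iff_has_vector_derivative
    using bounded_linear.has_vector_derivative[OF bounded_linear_Re] by blast
qed

section \<open>Abel integrals\<close>

text \<open>Reduces \<open>phi'\<close> to the second derivative of an explicit formula
  \<open>J\<close> for the Abel integral. The formula has to match only up to 1, because derivatives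
  within [0, 1] see nothing beyond; \<open>J\<close> itself is differentiated two-sidedly, which
  also covers s = 1.\<close>

lemma phi'_eqI:
  assumes U: "open U" "U \<subseteq> {0<..}" and s: "s \<in> U" "s \<le> 1"
    and J: "\<And>t. t \<in> U \<Longrightarrow> t \<le> 1 \<Longrightarrow> integral {0..t} (\<lambda>\<sigma>. psi \<Gamma> (t - \<sigma>) / sqrt \<sigma>) = J t"
    and J1: "\<And>t. t \<in> U \<Longrightarrow> (J has_real_derivative J1 t) (at t)"
    and J2: "(J1 has_real_derivative c) (at s)"
  shows "phi' \<Gamma> s = c / pi\<^sup>2"
proof -
  have ev: "eventually (\<lambda>x. x \<in> U) (nhds t)" if "t \<in> U" for t
    using U(1) that by (rule eventually_nhds_in_open)
  have phi: "phi \<Gamma> t = J1 t / pi\<^sup>2" if t: "t \<in> U" "t \<le> 1" for t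
  proof -
    have t0: "t > 0" using t U(2) by auto
    have "vector_derivative (\<lambda>t. integral {0..t} (\<lambda>\<sigma>. psi \<Gamma> (t - \<sigma>) / sqrt \<sigma>)) (at t within {0..1})
        = vector_derivative J (at t within {0..1})"
      by (rule vector_derivative_cong_eq)
         (use t t0 J in \<open>auto intro!: eventually_mono[OF ev[OF t(1)]]\<close>)
    also have "\<dots> = J1 t"
      by (rule vector_derivative_within_closed_interval)
         (use t t0 J1[OF t(1)] in \<open>auto simp: has_real_derivative_iff_has_vector_derivative
            intro: has_vector_derivative_at_within\<close>)
    finally show ?thesis using t0 by (simp add: phi_def)
  qed
  have s0: "s > 0" using s U(2) by auto
  have "phi' \<Gamma> s = vector_derivative (\<lambda>t. J1 t / pi\<^sup>2) (at s within {0..1})"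
    unfolding phi'_def
    by (rule vector_derivative_cong_eq)
       (use s s0 phi in \<open>auto intro!: eventually_mono[OF ev[OF s(1)]]\<close>)
  also have "\<dots> = c / pi\<^sup>2"
    by (rule vector_derivative_within_closed_interval)
       (use s s0 DERIV_cdivide[OF J2, of "pi\<^sup>2"] in
         \<open>auto simp: has_real_derivative_iff_has_vector_derivative
            intro: has_vector_derivative_at_within\<close>)
  finally show ?thesis .
qed

text \<open>The substitution w = sqrt (\<sigma> / t) absorbs the singular kernel and fixes the
  domain of integration, so \<open>t\<close> survives only in the argument of \<open>g\<close> and
  in the prefactor.\<close>

lemma has_integral_abel_substitution:
  fixes g :: "real \<Rightarrow> real"
  assumes t: "t > 0" and g: "continuous_on {0..t} g"
  shows "((\<lambda>\<sigma>. g (t - \<sigma>) / sqrt \<sigma>) has_integral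
    2 * sqrt t * integral {0..1} (\<lambda>w. g (t * (1 - w\<^sup>2)))) {0..t}"
proof -
  have le: "w\<^sup>2 \<le> 1" if "0 \<le> w" "w \<le> 1" for w :: real
    using that by (simp add: power_le_one)
  have "((\<lambda>\<sigma>. (1 / (2 * sqrt \<sigma> * sqrt t)) *\<^sub>R g (t * (1 - (sqrt \<sigma> / sqrt t)\<^sup>2))) has_integral
     integral {sqrt 0 / sqrt t..sqrt t / sqrt t} (\<lambda>w. g (t * (1 - w\<^sup>2)))) {0..t}"
  proof (rule has_integral_substitution_strong[where c = 0 and d = 1])
    show "continuous_on {0..1} (\<lambda>w. g (t * (1 - w\<^sup>2)))"
      by (rule continuous_on_compose2[OF g])
         (use t le in \<open>auto intro!: continuous_intros mult_left_le\<close>)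
    show "(\<lambda>\<sigma>. sqrt \<sigma> / sqrt t) ` {0..t} \<subseteq> {0..1}" using t by (auto simp: divide_simps)
    show "continuous_on {0..t} (\<lambda>\<sigma>. sqrt \<sigma> / sqrt t)"
      using t by (intro continuous_intros) auto
    \<comment> \<open>The square root is not differentiable at 0, which is therefore the exceptional
      point of the substitution rule.\<close>
    show "finite {0 :: real}" by simp
    fix \<sigma> assume "\<sigma> \<in> {0..t} - {0}"
    thus "((\<lambda>\<sigma>. sqrt \<sigma> / sqrt t) has_real_derivative 1 / (2 * sqrt \<sigma> * sqrt t)) (at \<sigma> within {0..t})"
      using t by (auto intro!: derivative_eq_intros simp: field_simps)
  qed (use t in auto)
  hence "((\<lambda>\<sigma>. (2 * sqrt t) * ((1 / (2 * sqrt \<sigma> * sqrt t)) *\<^sub>R g (t * (1 - (sqrt \<sigma> / sqrt t)\<^sup>2))))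
      has_integral (2 * sqrt t) * integral {0..1} (\<lambda>w. g (t * (1 - w\<^sup>2)))) {0..t}"
    using t by (intro has_integral_mult_right) simp
  thus ?thesis
  proof (rule has_integral_eq[rotated])
    \<comment> \<open>The equality holds at \<sigma> = 0 too: division by zero makes both sides
      0.\<close>
    fix \<sigma> assume \<sigma>: "\<sigma> \<in> {0..t}"
    have "t * (1 - (sqrt \<sigma> / sqrt t)\<^sup>2) = t - \<sigma>"
      using t \<sigma> by (simp add: power_divide field_simps)
    thus "(2 * sqrt t) * ((1 / (2 * sqrt \<sigma> * sqrt t)) *\<^sub>R g (t * (1 - (sqrt \<sigma> / sqrt t)\<^sup>2)))
        = g (t - \<sigma>) / sqrt \<sigma>"
      using t by simp
  qed
qed

section \<open>Moments of the desingularized Abel integral\<close>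

lemma integral_one_minus_square: "integral {0..1} (\<lambda>w::real. 1 - w\<^sup>2) = 2 / 3"
proof -
  have "((\<lambda>w::real. 1 - w\<^sup>2) has_integral (1 - 1 ^ 3 / 3) - (0 - 0 ^ 3 / 3)) {0..1}"
    by (rule fundamental_theorem_of_calculus)
       (auto intro!: derivative_eq_intros simp flip: has_real_derivative_iff_has_vector_derivative)
  thus ?thesis by (simp add: integral_unique)
qed

text \<open>The exponent \<open>n\<close> counts the factors 1 - w^2 that differentiation in
  \<open>t\<close> brings out of the argument of \<open>g\<close>.\<close>

definition abel_moment :: "nat \<Rightarrow> (real \<Rightarrow> real) \<Rightarrow> real \<Rightarrow> real" where
  "abel_moment n g t = integral {0..1} (\<lambda>w. (1 - w\<^sup>2) ^ n * g (t * (1 - w\<^sup>2)))"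

lemma mult_one_minus_square_in_interval:
  fixes t :: real
  assumes "t \<in> {-b<..<b}" "w \<in> {0..1}"
  shows "t * (1 - w\<^sup>2) \<in> {-b<..<b}"
proof -
  have w: "0 \<le> 1 - w\<^sup>2" "1 - w\<^sup>2 \<le> 1" using assms(2) by (auto simp: power_le_one)
  have "\<bar>t * (1 - w\<^sup>2)\<bar> \<le> \<bar>t\<bar> * 1"
    unfolding abs_mult using w by (intro mult_left_mono) auto
  thus ?thesis using assms(1) by auto
qed

lemma continuous_on_abel_integrand:
  fixes g :: "real \<Rightarrow> real"
  assumes "continuous_on {-b<..<b} g"
  shows "continuous_on ({-b<..<b} \<times> {0..1}) (\<lambda>(t, w). (1 - w\<^sup>2) ^ n * g (t * (1 - w\<^sup>2)))"
proof -
  have "continuous_on ({-b<..<b} \<times> {0..1}) (\<lambda>p. g (fst p * (1 - (snd p)\<^sup>2)))"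
  proof (rule continuous_on_compose2[OF assms])
    show "(\<lambda>p. fst p * (1 - (snd p)\<^sup>2)) ` ({-b<..<b} \<times> {0..1}) \<subseteq> {-b<..<b}"
      by (clarsimp simp del: greaterThanLessThan_iff atLeastAtMost_iff) (rule mult_one_minus_square_in_interval)
  qed (intro continuous_intros)
  thus ?thesis
    unfolding split_beta by (intro continuous_intros)
qed

lemma continuous_on_abel_moment:
  assumes "continuous_on {-b<..<b} g"
  shows "continuous_on {-b<..<b} (abel_moment n g)"
  unfolding abel_moment_def[abs_def] interval_cbox
  by (rule integral_continuous_on_param)
     (use continuous_on_abel_integrand[OF assms] in \<open>simp add: box_real\<close>)

lemma abel_integrand_integrable:
  fixes g :: "real \<Rightarrow> real"
  assumes g: "continuous_on {-b<..<b} g" and t: "t \<in> {-b<..<b}"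
  shows "(\<lambda>w. (1 - w\<^sup>2) ^ n * g (t * (1 - w\<^sup>2))) integrable_on {0..1}"
proof -
  have "continuous_on {0..1} (\<lambda>w. g (t * (1 - w\<^sup>2)))"
  proof (rule continuous_on_compose2[OF g])
    show "(\<lambda>w. t * (1 - w\<^sup>2)) ` {0..1} \<subseteq> {-b<..<b}"
      using mult_one_minus_square_in_interval[OF t] by blast
  qed (intro continuous_intros)
  thus ?thesis
    by (intro integrable_continuous_real continuous_intros)
qed

text \<open>Differentiation under the integral sign over a compact interval. The symmetric domain
  makes 0 an interior point, so the derivative at 0 is included; the mean value theorem on [0, t]
  later relies on it.\<close>

lemma has_real_derivative_abel_moment:
  assumes g: "\<And>x. x \<in> {-b<..<b} \<Longrightarrow> (g has_real_derivative g' x) (at x)"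
    and g': "continuous_on {-b<..<b} g'" and t: "t \<in> {-b<..<b}"
  shows "(abel_moment n g has_real_derivative abel_moment (Suc n) g' t) (at t)"
proof -
  have cont: "continuous_on {-b<..<b} g"
    by (rule DERIV_continuous_on) (use g DERIV_subset in blast)
  have "(abel_moment n g has_real_derivative abel_moment (Suc n) g' t) (at t within {-b<..<b})"
    unfolding abel_moment_def[abs_def] interval_cbox
  proof (rule leibniz_rule_field_derivative[OF _ _ _ t])
    fix x w :: real assume xw: "x \<in> {-b<..<b}" "w \<in> cbox 0 1"
    have "(g has_real_derivative g' (x * (1 - w\<^sup>2))) (at (x * (1 - w\<^sup>2)))"
      by (rule g) (use xw mult_one_minus_square_in_interval in auto)
    hence "((\<lambda>x. g (x * (1 - w\<^sup>2))) has_real_derivative g' (x * (1 - w\<^sup>2)) * (1 - w\<^sup>2))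
        (at x within {-b<..<b})"
      by (rule DERIV_chain2) (auto intro!: derivative_eq_intros)
    from DERIV_cmult[OF this, of "(1 - w\<^sup>2) ^ n"]
    show "((\<lambda>x. (1 - w\<^sup>2) ^ n * g (x * (1 - w\<^sup>2))) has_real_derivative
        (1 - w\<^sup>2) ^ Suc n * g' (x * (1 - w\<^sup>2))) (at x within {-b<..<b})"
      by (simp add: mult_ac)
  next
    show "(\<lambda>w. (1 - w\<^sup>2) ^ n * g (x * (1 - w\<^sup>2))) integrable_on cbox 0 1" if "x \<in> {-b<..<b}" for x
      using abel_integrand_integrable[OF cont that] by (simp add: box_real)
  next
    show "continuous_on ({-b<..<b} \<times> cbox 0 1) (\<lambda>(x, w). (1 - w\<^sup>2) ^ Suc n * g' (x * (1 - w\<^sup>2)))"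
      using continuous_on_abel_integrand[OF g', of "Suc n"] by (simp add: box_real)
  qed simp
  thus ?thesis by (simp only: at_within_open[OF t open_greaterThanLessThan])
qed

text \<open>The argument t (1 - w^2) stays in [0, t], the weight is at most 1, and the interval of
  integration has length 1.\<close>

lemma abs_abel_moment_le:
  assumes g: "continuous_on {-b<..<b} g" and t: "t \<in> {0..<b}"
    and C: "\<And>x. x \<in> {0..t} \<Longrightarrow> \<bar>g x\<bar> \<le> C"
  shows "\<bar>abel_moment n g t\<bar> \<le> C"
proof -
  have t': "t \<in> {-b<..<b}" using t by auto
  have C0: "0 \<le> C" using C[of 0] t by auto
  have "norm (integral {0..1} (\<lambda>w. (1 - w\<^sup>2) ^ n * g (t * (1 - w\<^sup>2)))) \<le> integral {0..1::real} (\<lambda>_. C)"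
  proof (rule integral_norm_bound_integral[OF abel_integrand_integrable[OF g t']])
    fix w :: real assume w: "w \<in> {0..1}"
    hence w': "0 \<le> 1 - w\<^sup>2" "1 - w\<^sup>2 \<le> 1" by (auto simp: power_le_one)
    have "norm ((1 - w\<^sup>2) ^ n * g (t * (1 - w\<^sup>2))) = (1 - w\<^sup>2) ^ n * \<bar>g (t * (1 - w\<^sup>2))\<bar>"
      using w' by (simp add: abs_mult)
    also have "\<dots> \<le> 1 * C"
      by (rule mult_mono) (use w' t in \<open>auto intro!: C power_le_one mult_left_le\<close>)
    finally show "norm ((1 - w\<^sup>2) ^ n * g (t * (1 - w\<^sup>2))) \<le> C" by simp
  qed (rule integrable_const_ivl)
  thus ?thesis by (simp add: abel_moment_def)
qed

section \<open>Contribution of an initial segment to the Abel integral beyond it\<close>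

definition abel_tail :: "(real \<Rightarrow> real) \<Rightarrow> real \<Rightarrow> real \<Rightarrow> real \<Rightarrow> real" where
  "abel_tail k a p t = integral {0..a} (\<lambda>u. k u * (t - u) powr p)"

lemma abel_tail_integrable:
  fixes k :: "real \<Rightarrow> real"
  assumes k: "continuous_on {0..a} k" and t: "a < t"
  shows "(\<lambda>u. k u * (t - u) powr p) integrable_on {0..a}"
  by (rule integrable_continuous_real) (use t in \<open>auto intro!: continuous_intros k\<close>)

text \<open>For t > a the difference t - u stays positive on [0, a], so the kernel is smooth there
  and can be differentiated under the integral sign. Two derivatives lead from the exponent -1/2 to
  -5/2.\<close>

lemma has_real_derivative_abel_tail:
  assumes k: "continuous_on {0..a} k" and t: "a < t"
  shows "(abel_tail k a p has_real_derivative p * abel_tail k a (p - 1) t) (at t)"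
proof -
  have "(abel_tail k a p has_real_derivative integral {0..a} (\<lambda>u. k u * (p * (t - u) powr (p - 1))))
      (at t within {a<..})"
    unfolding abel_tail_def[abs_def] interval_cbox
  proof (rule leibniz_rule_field_derivative)
    fix x u :: real assume "x \<in> {a<..}" "u \<in> cbox 0 a"
    thus "((\<lambda>x. k u * (x - u) powr p) has_real_derivative k u * (p * (x - u) powr (p - 1)))
        (at x within {a<..})"
      by (auto intro!: derivative_eq_intros)
  next
    show "(\<lambda>u. k u * (x - u) powr p) integrable_on cbox 0 a" if "x \<in> {a<..}" for x
      using abel_tail_integrable[OF k, of x] that by (simp add: box_real)
  next
    show "continuous_on ({a<..} \<times> cbox 0 a) (\<lambda>(x, u). k u * (p * (x - u) powr (p - 1)))"
      unfolding split_beta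
      by (intro continuous_intros continuous_on_compose2[OF k]) auto
  qed (use t in auto)
  moreover have "integral {0..a} (\<lambda>u. k u * (p * (t - u) powr (p - 1))) = p * abel_tail k a (p - 1) t"
    unfolding abel_tail_def by (subst integral_mult_right[symmetric]) (simp add: mult_ac)
  moreover have "at t within {a<..} = at t" by (rule at_within_open) (use t in auto)
  ultimately show ?thesis by (simp only:)
qed

lemma has_integral_reflect_shift:
  fixes f :: "real \<Rightarrow> real"
  assumes "(f has_integral i) {0..t}"
  shows "((\<lambda>x. f (t - x)) has_integral i) {0..t}"
proof -
  have "((\<lambda>x. f (-1 *\<^sub>R x + t)) has_integral (1 / (\<bar>-1\<bar> ^ DIM(real))) *\<^sub>R i)
     ((\<lambda>x. (1 / (-1)) *\<^sub>R x + - ((1 / (-1)) *\<^sub>R t)) ` cbox 0 t)"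
    by (rule has_integral_affinity) (use assms in \<open>auto simp: box_real\<close>)
  moreover have "(\<lambda>x. (1 / (-1)) *\<^sub>R x + - ((1 / (-1)) *\<^sub>R t)) ` cbox 0 t = {0..t}"
    by (auto simp: box_real image_iff intro!: bexI[of _ "t - _"])
  ultimately show ?thesis by (simp add: algebra_simps)
qed

text \<open>The piecewise function is the identity plus the correction g u - u on [0, a]. By the
  substitution the identity contributes 2 sqrt t * t * 2/3; the correction, reflected by u = t -
  \<sigma>, is the tail.\<close>

lemma has_integral_abel_piecewise:
  assumes g: "continuous_on {0..a} g" and a: "0 \<le> a" "a < t"
  shows "((\<lambda>\<sigma>. (if t - \<sigma> \<le> a then g (t - \<sigma>) else t - \<sigma>) / sqrt \<sigma>) has_integral
    4 / 3 * t powr (3 / 2) + abel_tail (\<lambda>u. g u - u) a (- 1 / 2) t) {0..t}"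
proof -
  have t: "t > 0" using a by simp
  have "integral {0..1} (\<lambda>w. t * (1 - w\<^sup>2)) = t * (2 / 3)"
    by (subst integral_mult_right) (simp add: integral_one_minus_square)
  moreover have "t powr (3 / 2) = t * sqrt t"
    using t powr_add[of t 1 "1 / 2"] by (simp add: powr_half_sqrt)
  ultimately have 1: "((\<lambda>\<sigma>. (t - \<sigma>) / sqrt \<sigma>) has_integral 4 / 3 * t powr (3 / 2)) {0..t}"
    using has_integral_abel_substitution[OF t continuous_on_id] by (simp only: mult_ac) simp
  let ?f = "\<lambda>u. (g u - u) * (t - u) powr (- 1 / 2)"
  have "(?f has_integral abel_tail (\<lambda>u. g u - u) a (- 1 / 2) t) {0..a}"
    unfolding abel_tail_def
    by (intro integrable_integral abel_tail_integrable) (use a g in \<open>auto intro!: continuous_intros\<close>)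
  \<comment> \<open>Extension by 0 lets the reflection act on all of [0, t].\<close>
  hence "((\<lambda>u. if u \<in> {0..a} then ?f u else 0) has_integral
      abel_tail (\<lambda>u. g u - u) a (- 1 / 2) t) {0..t}"
    by (subst has_integral_restrict) (use a in auto)
  from has_integral_add[OF 1 has_integral_reflect_shift[OF this]] show ?thesis
  proof (rule has_integral_eq[rotated])
    fix \<sigma> assume \<sigma>: "\<sigma> \<in> {0..t}"
    show "(t - \<sigma>) / sqrt \<sigma> + (if t - \<sigma> \<in> {0..a} then ?f (t - \<sigma>) else 0) =
      (if t - \<sigma> \<le> a then g (t - \<sigma>) else t - \<sigma>) / sqrt \<sigma>"
    proof (cases "t - \<sigma> \<le> a")
      case True
      \<comment> \<open>The correction lives where t - \<sigma> \<le> a < t, which excludes the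
        singular point \<sigma> = 0.\<close>
      hence "\<sigma> > 0" using a \<sigma> by auto
      hence "\<sigma> powr (- 1 / 2) = 1 / sqrt \<sigma>"
        by (simp add: powr_minus_divide powr_half_sqrt)
      thus ?thesis using True \<sigma> by (simp add: diff_divide_distrib add_divide_distrib)
    qed simp
  qed
qed

lemma abel_tail_nonneg:
  assumes "continuous_on {0..a} k" "a < t" "\<And>u. u \<in> {0..a} \<Longrightarrow> 0 \<le> k u"
  shows "0 \<le> abel_tail k a p t"
  unfolding abel_tail_def by (rule integral_nonneg) (simp_all add: abel_tail_integrable assms)

text \<open>With \<epsilon> = t - a, it suffices to integrate over the window from a - 2 \<epsilon>
  to a - \<epsilon>. It has length \<epsilon>, \<open>k\<close> is at least c \<epsilon> on it, and
  t - u is at most 3 \<epsilon>, so the integral is at least of order \<epsilon> to the power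
  -1/2.\<close>

lemma filterlim_abel_tail_at_top:
  assumes k: "continuous_on {0..a} k" and a: "a > 0" and c: "c > 0"
    and nonneg: "\<And>u. u \<in> {0..a} \<Longrightarrow> 0 \<le> k u"
    and lower: "\<And>u. u \<in> {a / 2..a} \<Longrightarrow> c * (a - u) \<le> k u"
  shows "filterlim (abel_tail k a (- 5 / 2)) at_top (at_right a)"
proof (rule filterlim_at_top_mono)
  have "filterlim (\<lambda>\<epsilon>. \<epsilon> * (c * \<epsilon> * (3 * \<epsilon>) powr (- 5 / 2))) at_top (at_right 0)"
    using c by real_asymp
  thus "filterlim (\<lambda>t. (t - a) * (c * (t - a) * (3 * (t - a)) powr (- 5 / 2))) at_top (at_right a)"
    unfolding at_right_to_0[of a] filterlim_filtermap by simp
  \<comment> \<open>Keeping t - a below a/4 places the window above a/2, where \<open>lower\<close>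
    applies.\<close>
  have "eventually (\<lambda>t. t \<in> {a<..<a + a / 4}) (at_right a)"
    using a by (intro eventually_at_right_real) simp
  thus "eventually (\<lambda>t. (t - a) * (c * (t - a) * (3 * (t - a)) powr (- 5 / 2))
      \<le> abel_tail k a (- 5 / 2) t) (at_right a)"
  proof eventually_elim
    case (elim t)
    define \<epsilon> where "\<epsilon> = t - a"
    have \<epsilon>: "0 < \<epsilon>" "\<epsilon> < a / 4" "t = a + \<epsilon>" using elim by (auto simp: \<epsilon>_def)
    have sub: "{a - 2 * \<epsilon>..a - \<epsilon>} \<subseteq> {0..a}" using \<epsilon> by auto
    note int = abel_tail_integrable[OF k, of t "- 5 / 2"]
    have "\<epsilon> * (c * \<epsilon> * (3 * \<epsilon>) powr (- 5 / 2))
        = integral {a - 2 * \<epsilon>..a - \<epsilon>} (\<lambda>_. c * \<epsilon> * (3 * \<epsilon>) powr (- 5 / 2))"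
      using \<epsilon> by simp
    also have "\<dots> \<le> integral {a - 2 * \<epsilon>..a - \<epsilon>} (\<lambda>u. k u * (t - u) powr (- 5 / 2))"
    proof (rule integral_le)
      show "(\<lambda>u. k u * (t - u) powr (- 5 / 2)) integrable_on {a - 2 * \<epsilon>..a - \<epsilon>}"
        by (rule integrable_on_subinterval[OF int sub]) (use \<epsilon> in auto)
      fix u assume u: "u \<in> {a - 2 * \<epsilon>..a - \<epsilon>}"
      have "c * \<epsilon> \<le> c * (a - u)" using u c by (intro mult_left_mono) auto
      also have "\<dots> \<le> k u" using u \<epsilon> by (intro lower) auto
      finally have 1: "c * \<epsilon> \<le> k u" .
      have 2: "(3 * \<epsilon>) powr (- 5 / 2) \<le> (t - u) powr (- 5 / 2)"
        by (rule powr_mono2') (use u \<epsilon> in auto)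
      show "c * \<epsilon> * (3 * \<epsilon>) powr (- 5 / 2) \<le> k u * (t - u) powr (- 5 / 2)"
        by (rule mult_mono[OF 1 2]) (use u sub nonneg in auto)
    qed (rule integrable_const_ivl)
    also have "\<dots> \<le> abel_tail k a (- 5 / 2) t"
      unfolding abel_tail_def
      by (rule integral_subset_le[OF sub])
         (use integrable_on_subinterval[OF int sub] int \<epsilon> nonneg in auto)
    finally show ?case by (simp add: \<epsilon>_def)
  qed
qed

section \<open>The derivative of the profile\<close>

context gamma_near_one
begin

definition psi_re :: "nat \<Rightarrow> real \<Rightarrow> real" where
  "psi_re n x = Re ((deriv ^^ n) (psi_tilde \<Gamma>) (of_real x))"

lemma has_real_derivative_psi_re:
  assumes "x \<in> {-(1/4)<..<1/4}"
  shows "(psi_re n has_real_derivative psi_re (Suc n) x) (at x within S)"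
proof -
  have "((deriv ^^ n) (psi_tilde \<Gamma>) has_field_derivative
      (deriv ^^ Suc n) (psi_tilde \<Gamma>) (of_real x)) (at (of_real x))"
    unfolding funpow.simps(2) o_apply
    by (rule holomorphic_derivI[OF holomorphic_higher_deriv[OF holomorphic_psi_tilde]])
       (use assms in auto)
  thus ?thesis
    unfolding psi_re_def[abs_def] by (rule has_real_derivative_Re_of_real)
qed

lemma continuous_on_psi_re: "continuous_on {-(1/4)<..<1/4} (psi_re n)"
  by (rule DERIV_continuous_on) (rule has_real_derivative_psi_re)

lemma psi_eq: "psi \<Gamma> s = (if s \<le> 1 - \<Gamma> then psi_re 0 s else s)"
  by (simp add: psi_def psi_re_def)

lemma psi_re_0_0: "psi_re 0 0 = 0"
  by (simp add: psi_re_def psi_tilde_0)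

text \<open>The value is 1 / \<Gamma>.\<close>

lemma psi_re_1_0_ge: "1 \<le> psi_re 1 0"
  using Gamma_ge Gamma_less by (simp add: psi_re_def deriv_psi_tilde_0)

lemma abs_psi_re_2_le: "\<bar>x\<bar> \<le> 1 / 16 \<Longrightarrow> \<bar>psi_re 2 x\<bar> \<le> 256"
  using norm_deriv2_psi_tilde_le[of "of_real x"]
    abs_Re_le_cmod[of "deriv (deriv (psi_tilde \<Gamma>)) (of_real x)"]
  by (simp add: psi_re_def numeral_2_eq_2)

section \<open>The profile to the left of 1 - \<Gamma>\<close>

definition moment :: "nat \<Rightarrow> real \<Rightarrow> real" where
  "moment n = abel_moment n (psi_re n)"

text \<open>Weight exponent and order of the derivative of \<open>psi_tilde\<close> share one index,
  so differentiation just raises it by one.\<close>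

lemma has_real_derivative_moment:
  assumes "x \<in> {-(1/4)<..<1/4}"
  shows "(moment n has_real_derivative moment (Suc n) x) (at x)"
  unfolding moment_def
  by (rule has_real_derivative_abel_moment[OF _ continuous_on_psi_re assms])
     (rule has_real_derivative_psi_re)

text \<open>Second derivative of \<open>2 * sqrt t * moment 0 t\<close>, without the factor 1 /
  pi^2.\<close>

definition phi'_left :: "real \<Rightarrow> real" where
  "phi'_left t = (2 * moment 1 t - moment 0 t / (2 * t)) / sqrt t + 2 * sqrt t * moment 2 t"

lemma phi'_eq_left:
  assumes s: "s \<in> {0<..<1 - \<Gamma>}"
  shows "phi' \<Gamma> s = phi'_left s / pi\<^sup>2"
proof (rule phi'_eqI)
  show "open {0<..<1 - \<Gamma>}" by simp
  fix t assume t: "t \<in> {0<..<1 - \<Gamma>}"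
  hence t': "t \<in> {-(1/4)<..<1/4}" using Gamma_ge by auto
  have "((\<lambda>\<sigma>. psi_re 0 (t - \<sigma>) / sqrt \<sigma>) has_integral
    2 * sqrt t * integral {0..1} (\<lambda>w. psi_re 0 (t * (1 - w\<^sup>2)))) {0..t}"
    by (rule has_integral_abel_substitution)
       (use t t' in \<open>auto intro!: continuous_on_subset[OF continuous_on_psi_re]\<close>)
  hence "((\<lambda>\<sigma>. psi_re 0 (t - \<sigma>) / sqrt \<sigma>) has_integral 2 * sqrt t * moment 0 t) {0..t}"
    by (simp add: moment_def abel_moment_def)
  \<comment> \<open>All arguments t - \<sigma> lie below 1 - \<Gamma>, so only the series branch of
    \<open>psi\<close> occurs.\<close>
  hence "((\<lambda>\<sigma>. psi \<Gamma> (t - \<sigma>) / sqrt \<sigma>) has_integral 2 * sqrt t * moment 0 t) {0..t}"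
    by (rule has_integral_eq[rotated, where f = "\<lambda>\<sigma>. psi_re 0 (t - \<sigma>) / sqrt \<sigma>"])
       (use t in \<open>auto simp: psi_eq\<close>)
  thus "integral {0..t} (\<lambda>\<sigma>. psi \<Gamma> (t - \<sigma>) / sqrt \<sigma>) = 2 * sqrt t * moment 0 t"
    by (rule integral_unique)
  show "((\<lambda>t. 2 * sqrt t * moment 0 t) has_real_derivative
      moment 0 t / sqrt t + 2 * sqrt t * moment 1 t) (at t)"
    using has_real_derivative_moment[OF t', of 0] t
    by (auto intro!: derivative_eq_intros simp: field_simps)
next
  have s': "s \<in> {-(1/4)<..<1/4}" using s Gamma_ge by auto
  have m1: "(moment 1 has_real_derivative moment 2 s) (at s)"
    using has_real_derivative_moment[OF s', of 1] by (simp add: numeral_2_eq_2)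
  have m0: "(moment 0 has_real_derivative moment 1 s) (at s)"
    using has_real_derivative_moment[OF s', of 0] by simp
  \<comment> \<open>With s = r * r, comparing the two forms of the derivative becomes a rational
    identity in r.\<close>
  define r where "r = sqrt s"
  have r: "r > 0" "s = r * r" using s by (simp_all add: r_def)
  have sqrt: "(sqrt has_real_derivative inverse r / 2) (at s)"
    unfolding r_def by (rule DERIV_real_sqrt) (use s in simp)
  have "((\<lambda>t. moment 0 t / sqrt t + 2 * sqrt t * moment 1 t) has_real_derivative
      (moment 1 s * sqrt s - moment 0 s * (inverse r / 2)) / (sqrt s * sqrt s) +
      ((2 * (inverse r / 2)) * moment 1 s + moment 2 s * (2 * sqrt s))) (at s)"
    by (intro DERIV_add DERIV_divide DERIV_mult DERIV_cmult m0 m1 sqrt) (use s in simp)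
  moreover have "(moment 1 s * sqrt s - moment 0 s * (inverse r / 2)) / (sqrt s * sqrt s) +
      ((2 * (inverse r / 2)) * moment 1 s + moment 2 s * (2 * sqrt s)) = phi'_left s"
  proof -
    have "(m1 * r - m0 * (inverse r / 2)) / (r * r) + ((2 * (inverse r / 2)) * m1 + m2 * (2 * r)) =
        (2 * m1 - m0 / (2 * (r * r))) / r + 2 * r * m2" for m0 m1 m2
      using r(1) by (simp add: field_simps)
    thus ?thesis
      unfolding phi'_left_def r_def[symmetric] using r(2) by simp
  qed
  ultimately show "((\<lambda>t. moment 0 t / sqrt t + 2 * sqrt t * moment 1 t) has_real_derivative
      phi'_left s) (at s)"
    by (simp only:)
qed (use s Gamma_ge in auto)

text \<open>The interval reaches past 1 - \<Gamma>, so the formula supplies the left limit of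
  \<open>phi'\<close> there.\<close>

lemma continuous_on_phi'_left: "continuous_on {0<..<1/4} phi'_left"
proof -
  have "continuous_on {0<..<1/4} (moment n)" for n
    unfolding moment_def
    by (rule continuous_on_subset[OF continuous_on_abel_moment[OF continuous_on_psi_re]]) auto
  thus ?thesis
    unfolding phi'_left_def[abs_def] by (intro continuous_intros) auto
qed

text \<open>By the mean value theorem, sqrt t * phi'_left t equals 3/2 * moment 1 0 = psi' 0 up to an
  error of at most 1152 t, and 1152 / 2^12 < 1/2.\<close>
lemma phi'_left_ge:
  assumes t: "t \<in> {0<..1 - \<Gamma>}"
  shows "1 / (2 * sqrt t) \<le> phi'_left t"
proof -
  have t': "0 < t" "t \<le> 1 / 2 ^ 12" using t Gamma_ge by auto
  have m2: "\<bar>moment 2 x\<bar> \<le> 256" if "x \<in> {0..t}" for x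
    unfolding moment_def
    by (rule abs_abel_moment_le[OF continuous_on_psi_re])
       (use that t' abs_psi_re_2_le in auto)
  have m1: "\<bar>moment 1 x - moment 1 0\<bar> \<le> 256 * t" if x: "x \<in> {0..t}" for x
  proof (cases "x = 0")
    case False
    have "\<exists>z. 0 < z \<and> z < x \<and> moment 1 x - moment 1 0 = (x - 0) * moment (Suc 1) z"
      by (rule MVT2) (use x False t' in \<open>auto intro!: has_real_derivative_moment\<close>)
    then obtain z where z: "0 < z" "z < x" "moment 1 x - moment 1 0 = x * moment 2 z"
      by (auto simp: numeral_2_eq_2)
    have "\<bar>x * moment 2 z\<bar> \<le> t * 256"
      unfolding abs_mult by (rule mult_mono) (use x z m2[of z] in auto)
    thus ?thesis unfolding z(3) by simp
  qed (use t' in simp)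
  have "moment 0 0 = 0" by (simp add: moment_def abel_moment_def psi_re_0_0)
  moreover have "\<exists>z. 0 < z \<and> z < t \<and> moment 0 t - moment 0 0 = (t - 0) * moment (Suc 0) z"
    by (rule MVT2) (use t' in \<open>auto intro!: has_real_derivative_moment\<close>)
  ultimately obtain z where z: "0 < z" "z < t" "moment 0 t = t * moment 1 z" by auto
  have m10: "moment 1 0 = 2 / 3 * psi_re 1 0"
    by (simp add: moment_def abel_moment_def integral_one_minus_square)
  have "\<bar>t * moment 2 t\<bar> \<le> t * 256"
    unfolding abs_mult using m2[of t] t' by (intro mult_mono) auto
  moreover have "moment 0 t / (2 * t) = moment 1 z / 2" using z t' by simp
  ultimately have "1 / 2 \<le> (2 * moment 1 t - moment 0 t / (2 * t)) + 2 * (t * moment 2 t)"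
    using m1[of t] m1[of z] m10 psi_re_1_0_ge t' z by simp
  hence "1 / 2 / sqrt t \<le> ((2 * moment 1 t - moment 0 t / (2 * t)) + 2 * (t * moment 2 t)) / sqrt t"
    by (rule divide_right_mono) (use t' in simp)
  also have "\<dots> = phi'_left t"
    unfolding phi'_left_def using t' by (simp add: add_divide_distrib field_simps)
  finally show ?thesis by simp
qed

section \<open>The profile to the right of 1 - \<Gamma>\<close>

definition excess :: "real \<Rightarrow> real" where "excess u = psi_re 0 u - u"

lemma continuous_on_excess: "continuous_on {0..1 - \<Gamma>} excess"
  unfolding excess_def[abs_def]
  by (intro continuous_intros continuous_on_subset[OF continuous_on_psi_re])
     (use Gamma_ge in auto)

text \<open>The second term of the series suffices, since dividing by 1 - u, a number in ]0, 1],
  only enlarges it. The bound vanishes just to first order at u = 1 - \<Gamma>, which is what forces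
  the blow-up.\<close>

lemma excess_ge:
  assumes u: "u \<in> {0..1 - \<Gamma>}"
  shows "u * (1 - \<Gamma> - u) \<le> excess u"
proof -
  have "u * (1 - \<Gamma> - u) \<le> u * (1 - \<Gamma> - u) / (1 - u)"
    using u Gamma_ge mult_left_le[of "1 - u" "u * (1 - \<Gamma> - u)"] by (simp add: le_divide_eq)
  also have "\<dots> \<le> excess u"
    using Re_psi_tilde_ge[OF u] by (simp add: excess_def psi_re_def)
  finally show ?thesis .
qed

lemma excess_nonneg:
  assumes u: "u \<in> {0..1 - \<Gamma>}"
  shows "0 \<le> excess u"
proof -
  have "0 \<le> u * (1 - \<Gamma> - u)" using u by simp
  with excess_ge[OF u] show ?thesis by linarith
qed

text \<open>Second derivative of \<open>4 / 3 * t powr (3 / 2) + abel_tail excess (1 - \<Gamma>) (-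
  1 / 2) t\<close>, without the factor 1 / pi^2; 3/4 is the product of -1/2 and -3/2.\<close>

definition phi'_right :: "real \<Rightarrow> real" where
  "phi'_right t = t powr (- 1 / 2) + 3 / 4 * abel_tail excess (1 - \<Gamma>) (- 5 / 2) t"

lemma phi'_eq_right:
  assumes s: "s \<in> {1 - \<Gamma><..1}"
  shows "phi' \<Gamma> s = phi'_right s / pi\<^sup>2"
proof (rule phi'_eqI)
  let ?B = "abel_tail excess (1 - \<Gamma>)"
  \<comment> \<open>The open set extends beyond 1, so s = 1 is one of its interior points.\<close>
  show "open {1 - \<Gamma><..}" by simp
  fix t assume t: "t \<in> {1 - \<Gamma><..}"
  have t0: "t > 0" using t Gamma_less by auto
  show "integral {0..t} (\<lambda>\<sigma>. psi \<Gamma> (t - \<sigma>) / sqrt \<sigma>) = 4 / 3 * t powr (3 / 2) + ?B (- 1 / 2) t"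
    unfolding psi_eq excess_def[abs_def]
    by (intro integral_unique has_integral_abel_piecewise continuous_on_subset[OF continuous_on_psi_re])
       (use t Gamma_ge Gamma_less in auto)
  have B: "(?B (- 1 / 2) has_real_derivative - 1 / 2 * ?B (- 3 / 2) t) (at t)"
    using has_real_derivative_abel_tail[OF continuous_on_excess, of t "- 1 / 2"] t by simp
  show "((\<lambda>t. 4 / 3 * t powr (3 / 2) + ?B (- 1 / 2) t) has_real_derivative
      2 * t powr (1 / 2) - 1 / 2 * ?B (- 3 / 2) t) (at t)"
    by (rule derivative_eq_intros B refl | use t0 in simp)+
next
  let ?B = "abel_tail excess (1 - \<Gamma>)"
  have s0: "s > 0" using s Gamma_less by auto
  have B: "(?B (- 3 / 2) has_real_derivative - 3 / 2 * ?B (- 5 / 2) s) (at s)"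
    using has_real_derivative_abel_tail[OF continuous_on_excess, of s "- 3 / 2"] s by simp
  show "((\<lambda>t. 2 * t powr (1 / 2) - 1 / 2 * ?B (- 3 / 2) t) has_real_derivative phi'_right s) (at s)"
    by (rule derivative_eq_intros B refl | use s0 in \<open>simp add: phi'_right_def\<close>)+
qed (use s Gamma_less in auto)

lemma continuous_on_phi'_right: "continuous_on {1 - \<Gamma><..} phi'_right"
proof -
  have "continuous_on {1 - \<Gamma><..} (abel_tail excess (1 - \<Gamma>) (- 5 / 2))"
    by (rule DERIV_continuous_on)
       (use has_real_derivative_abel_tail[OF continuous_on_excess] DERIV_subset in blast)
  thus ?thesis
    unfolding phi'_right_def[abs_def] by (intro continuous_intros) (use Gamma_less in auto)
qed

lemma phi'_right_pos:
  assumes "1 - \<Gamma> < t"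
  shows "0 < phi'_right t"
proof -
  have "0 \<le> abel_tail excess (1 - \<Gamma>) (- 5 / 2) t"
    by (rule abel_tail_nonneg[OF continuous_on_excess assms excess_nonneg])
  moreover have "0 < t powr (- 1 / 2)" using assms Gamma_less by simp
  ultimately show ?thesis unfolding phi'_right_def by linarith
qed

lemma filterlim_phi'_right: "filterlim phi'_right at_top (at_right (1 - \<Gamma>))"
proof (rule filterlim_at_top_mono)
  have "filterlim (abel_tail excess (1 - \<Gamma>) (- 5 / 2)) at_top (at_right (1 - \<Gamma>))"
  \<comment> \<open>The slope \<open>c\<close> is the smallest value of the factor u on the right
    half of the segment.\<close>
  proof (rule filterlim_abel_tail_at_top[OF continuous_on_excess, where c = "(1 - \<Gamma>) / 2"])
    fix u assume u: "u \<in> {(1 - \<Gamma>) / 2..1 - \<Gamma>}"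
    have "(1 - \<Gamma>) / 2 * (1 - \<Gamma> - u) \<le> u * (1 - \<Gamma> - u)"
      by (rule mult_right_mono) (use u in auto)
    also have "\<dots> \<le> excess u" by (rule excess_ge) (use u Gamma_less in auto)
    finally show "(1 - \<Gamma>) / 2 * (1 - \<Gamma> - u) \<le> excess u" .
  qed (use Gamma_less excess_nonneg in auto)
  thus "filterlim (\<lambda>t. 3 / 4 * abel_tail excess (1 - \<Gamma>) (- 5 / 2) t) at_top (at_right (1 - \<Gamma>))"
    by (intro filterlim_tendsto_pos_mult_at_top[OF tendsto_const]) auto
qed (simp add: phi'_right_def)

section \<open>Positivity, continuity and limits of \<open>phi'\<close>\<close>

lemma phi'_pos: "s \<in> {0<..1} - {1 - \<Gamma>} \<Longrightarrow> 0 < phi' \<Gamma> s"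
proof (cases "s < 1 - \<Gamma>")
  case True
  assume s: "s \<in> {0<..1} - {1 - \<Gamma>}"
  have "0 < 1 / (2 * sqrt s)" using s by simp
  also have "\<dots> \<le> phi'_left s" by (rule phi'_left_ge) (use s True in auto)
  finally show ?thesis using phi'_eq_left s True by simp
next
  case False
  assume "s \<in> {0<..1} - {1 - \<Gamma>}"
  thus ?thesis using phi'_eq_right phi'_right_pos False by simp
qed

text \<open>Removing 1 - \<Gamma> leaves two pieces covered by disjoint open sets, so the two
  formulas glue whatever they do at 1 - \<Gamma>.\<close>

lemma continuous_on_phi': "continuous_on ({0<..1} - {1 - \<Gamma>}) (phi' \<Gamma>)"
proof -
  have L: "continuous_on {0<..<1 - \<Gamma>} phi'_left"
    by (rule continuous_on_subset[OF continuous_on_phi'_left]) (use Gamma_ge in auto)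
  have "continuous_on ({0<..<1 - \<Gamma>} \<union> {1 - \<Gamma><..}) (\<lambda>s. if s < 1 - \<Gamma> then phi'_left s else phi'_right s)"
    by (rule continuous_on_open_Un)
       (use continuous_on_eq[OF L] continuous_on_eq[OF continuous_on_phi'_right] in auto)
  hence "continuous_on ({0<..1} - {1 - \<Gamma>})
      (\<lambda>s. (if s < 1 - \<Gamma> then phi'_left s else phi'_right s) / pi\<^sup>2)"
    by (intro continuous_intros) (auto elim: continuous_on_subset)
  thus ?thesis
    by (rule continuous_on_eq) (auto simp: phi'_eq_left phi'_eq_right)
qed

text \<open>\<open>phi'_left\<close> is continuous across 1 - \<Gamma>, although it describes
  \<open>phi'\<close> only on the left.\<close>

lemma tendsto_phi'_at_left: "(phi' \<Gamma> \<longlongrightarrow> phi'_left (1 - \<Gamma>) / pi\<^sup>2) (at_left (1 - \<Gamma>))"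
proof -
  have "isCont phi'_left (1 - \<Gamma>)"
    using continuous_on_phi'_left by (rule continuous_on_interior) (use Gamma_ge Gamma_less in auto)
  hence "((\<lambda>s. phi'_left s / pi\<^sup>2) \<longlongrightarrow> phi'_left (1 - \<Gamma>) / pi\<^sup>2) (at_left (1 - \<Gamma>))"
    by (intro tendsto_intros) (auto simp: isCont_def intro: tendsto_mono[OF at_le])
  moreover have "eventually (\<lambda>s. phi'_left s / pi\<^sup>2 = phi' \<Gamma> s) (at_left (1 - \<Gamma>))"
    using eventually_at_left_real[of 0 "1 - \<Gamma>"] Gamma_less
    by (auto elim!: eventually_mono simp: phi'_eq_left)
  ultimately show ?thesis by (rule Lim_transform_eventually)
qed

text \<open>Comparison with the lower bound from \<open>phi'_left_ge\<close>, which blows up at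
  0.\<close>

lemma filterlim_phi'_at_right_0: "filterlim (phi' \<Gamma>) at_top (at_right 0)"
proof (rule filterlim_at_top_mono)
  show "filterlim (\<lambda>s::real. 1 / (2 * sqrt s) / pi\<^sup>2) at_top (at_right 0)"
    by real_asymp
  have "eventually (\<lambda>s. s \<in> {0<..<1 - \<Gamma>}) (at_right 0)"
    using Gamma_less by (intro eventually_at_right_real) simp
  thus "eventually (\<lambda>s. 1 / (2 * sqrt s) / pi\<^sup>2 \<le> phi' \<Gamma> s) (at_right 0)"
  proof eventually_elim
    case (elim s)
    have "1 / (2 * sqrt s) / pi\<^sup>2 \<le> phi'_left s / pi\<^sup>2"
      by (intro divide_right_mono phi'_left_ge) (use elim in auto)
    thus ?case using elim by (simp add: phi'_eq_left)
  qed
qed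

lemma filterlim_phi'_at_right: "filterlim (phi' \<Gamma>) at_top (at_right (1 - \<Gamma>))"
proof (rule filterlim_cong[OF refl refl, THEN iffD1])
  show "filterlim (\<lambda>s. 1 / pi\<^sup>2 * phi'_right s) at_top (at_right (1 - \<Gamma>))"
    by (rule filterlim_tendsto_pos_mult_at_top[OF tendsto_const _ filterlim_phi'_right]) simp
  have "eventually (\<lambda>s. s \<in> {1 - \<Gamma><..<1}) (at_right (1 - \<Gamma>))"
    using Gamma_ge by (intro eventually_at_right_real) simp
  thus "eventually (\<lambda>s. 1 / pi\<^sup>2 * phi'_right s = phi' \<Gamma> s) (at_right (1 - \<Gamma>))"
    by eventually_elim (simp add: phi'_eq_right)
qed

end

section \<open>Phase space\<close>

lemma q_fun_eq: "q_fun p = 1 - s_fun p"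
  by (simp add: q_fun_def s_fun_def split_beta)

lemma continuous_on_s_fun: "continuous_on S s_fun"
  unfolding s_fun_def split_beta by (intro continuous_intros continuous_on_cross)

text \<open>The squared norm of a point is at most 1 + \<Gamma>, hence below 4. This provides the
  compact ball on which \<open>s_fun\<close> is uniformly continuous.\<close>

lemma D_set_subset_cball:
  assumes "\<Gamma> \<le> 1"
  shows "D_set \<Gamma> \<subseteq> cball 0 2"
proof
  fix p assume "p \<in> D_set \<Gamma>"
  hence "(norm (fst p))\<^sup>2 + (norm (snd p))\<^sup>2 \<le> 2\<^sup>2"
    using assms by (auto simp: D_set_def)
  hence "norm p \<le> 2"
    unfolding norm_prod_def by (intro real_le_lsqrt) auto
  thus "p \<in> cball 0 2" by simp
qed

text \<open>Distance to the set tending to 0 does not single out a limit point, so pointwise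
  continuity is not enough; uniform continuity on the ball compares \<open>s_fun p\<close> with its
  value c at a nearby point of \<open>A\<close>.\<close>

lemma tendsto_s_fun_approaching:
  assumes A: "A \<noteq> {}" "A \<subseteq> cball 0 r" "\<And>p. p \<in> A \<Longrightarrow> s_fun p = c" and S: "S \<subseteq> cball 0 r"
  shows "(s_fun \<longlongrightarrow> c) (approaching S A)"
proof (rule tendstoI)
  fix e :: real assume "e > 0"
  have "uniformly_continuous_on (cball 0 r) s_fun"
    by (rule compact_uniformly_continuous[OF continuous_on_s_fun]) simp
  from uniformly_continuous_onE[OF this \<open>e > 0\<close>] obtain d where d: "d > 0"
    "\<And>x x'. x \<in> cball 0 r \<Longrightarrow> x' \<in> cball 0 r \<Longrightarrow> dist x' x < d \<Longrightarrow> dist (s_fun x') (s_fun x) < e"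
    by metis
  have "eventually (\<lambda>p. infdist p A \<in> {..<d}) (filtercomap (\<lambda>p. infdist p A) (nhds 0))"
    by (rule eventually_filtercomapI[OF eventually_nhds_in_open]) (use d in auto)
  thus "eventually (\<lambda>p. dist (s_fun p) c < e) (approaching S A)"
    unfolding approaching_def eventually_inf_principal
  proof eventually_elim
    case (elim p)
    show ?case
    proof
      assume p: "p \<in> S"
      \<comment> \<open>The infimum being below d already gives a point at distance below d, without
        attainment.\<close>
      obtain q where q: "q \<in> A" "dist p q < d"
        using elim A(1) by (auto simp: infdist_notempty cInf_less_iff)
      have "dist (s_fun p) (s_fun q) < e"
        using d(2)[of q p] q p A(2) S by blast
      thus "dist (s_fun p) c < e" using A(3)[OF q(1)] by simp
    qed
  qed
qed

lemma eventually_approaching_mem: "eventually (\<lambda>p. p \<in> S) (approaching S A)"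
  unfolding approaching_def eventually_inf_principal by simp

text \<open>With v = 0 the cross product vanishes and \<open>q_fun\<close> is the squared norm of x.
  The witness shows that the level sets are nonempty; for an empty set \<open>infdist\<close> would
  be 0 by convention.\<close>

lemma axis_mem_level:
  assumes "0 \<le> c" "0 \<le> \<Gamma>"
  shows "(axis 1 (sqrt c), 0) \<in> {(x, v). q_fun (x, v) = c \<and> (norm (cross3 x v))\<^sup>2 \<le> \<Gamma>}"
  using assms by (simp add: q_fun_def power2_norm_eq_inner inner_axis_axis)

section \<open>Transfer from the profile to \<open>f_Gamma\<close>\<close>

context gamma_near_one
begin

lemma Gamma_nonneg: "0 \<le> \<Gamma>" using Gamma_ge by simp

lemma D_set_bounded: "D_set \<Gamma> \<subseteq> cball 0 2"
  by (rule D_set_subset_cball) (use Gamma_less in simp)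

lemma s_fun_D_set: "p \<in> D_set \<Gamma> \<Longrightarrow> s_fun p \<in> {0..1}"
  by (auto simp: D_set_def s_fun_def)

lemma f_Gamma_eq:
  assumes "p \<in> D_set \<Gamma>" "s_fun p \<in> {0<..1} - {1 - \<Gamma>}"
  shows "f_Gamma \<Gamma> p = 3 / (4 * pi) * phi' \<Gamma> (s_fun p)"
  using assms by (auto simp: f_Gamma_def D_set_def)

text \<open>As \<open>q_fun\<close> is 1 - \<open>s_fun\<close>, leaving out \<open>M_set\<close>
  and \<open>N_set\<close> excludes exactly the values 0 and 1 - \<Gamma>.\<close>

lemma s_fun_regular:
  assumes "p \<in> D_set \<Gamma> - (M_set \<Gamma> \<union> N_set \<Gamma>)"
  shows "s_fun p \<in> {0<..1} - {1 - \<Gamma>}"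
proof -
  have "s_fun p \<noteq> 0" "s_fun p \<noteq> 1 - \<Gamma>"
    using assms by (auto simp: M_set_def N_set_def q_fun_eq D_set_def)
  thus ?thesis using s_fun_D_set[of p] assms by auto
qed

lemma continuous_on_f_Gamma: "continuous_on (D_set \<Gamma> - (M_set \<Gamma> \<union> N_set \<Gamma>)) (f_Gamma \<Gamma>)"
proof (rule continuous_on_eq)
  show "continuous_on (D_set \<Gamma> - (M_set \<Gamma> \<union> N_set \<Gamma>)) (\<lambda>p. 3 / (4 * pi) * phi' \<Gamma> (s_fun p))"
    by (intro continuous_on_mult_left continuous_on_compose2[OF continuous_on_phi' continuous_on_s_fun]
        image_subsetI s_fun_regular)
qed (use s_fun_regular f_Gamma_eq in simp)

lemma f_Gamma_pos: "p \<in> D_set \<Gamma> - (M_set \<Gamma> \<union> N_set \<Gamma>) \<Longrightarrow> 0 < f_Gamma \<Gamma> p"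
  using f_Gamma_eq[of p] s_fun_regular[of p] phi'_pos[of "s_fun p"] by simp

lemma tendsto_s_fun_N:
  assumes "S \<subseteq> D_set \<Gamma>"
  shows "(s_fun \<longlongrightarrow> 1 - \<Gamma>) (approaching S (N_set \<Gamma>))"
proof (rule tendsto_s_fun_approaching)
  show "N_set \<Gamma> \<noteq> {}"
    using axis_mem_level[OF Gamma_nonneg Gamma_nonneg] unfolding N_set_def by blast
  show "N_set \<Gamma> \<subseteq> cball 0 2"
    using N_set_subset_D_set[OF Gamma_nonneg] D_set_bounded Gamma_less by auto
  show "S \<subseteq> cball 0 2" using assms D_set_bounded by blast
qed (auto simp: N_set_def q_fun_eq)

lemma tendsto_s_fun_M:
  assumes "S \<subseteq> D_set \<Gamma>"
  shows "(s_fun \<longlongrightarrow> 0) (approaching S (M_set \<Gamma>))"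
proof (rule tendsto_s_fun_approaching)
  show "M_set \<Gamma> \<noteq> {}"
    using axis_mem_level[of 1, OF _ Gamma_nonneg] unfolding M_set_def by force
  show "M_set \<Gamma> \<subseteq> cball 0 2"
    using M_set_subset_D_set D_set_bounded by blast
  show "S \<subseteq> cball 0 2" using assms D_set_bounded by blast
qed (auto simp: M_set_def q_fun_eq)

text \<open>Common reduction of the three limits to one-sided limits of \<open>phi'\<close>:
  \<open>T\<close> fixes the side from which \<open>s_fun\<close> tends to \<open>c\<close>, and
  \<open>ev\<close> keeps it at values where \<open>f_Gamma\<close> is given by \<open>phi'\<close>.
  The upper bound 1 comes from \<open>D_set\<close>.\<close>

lemma filterlim_f_Gamma:
  assumes S: "S \<subseteq> D_set \<Gamma>" "\<And>p. p \<in> S \<Longrightarrow> s_fun p \<in> T - {c}"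
    and lim: "(s_fun \<longlongrightarrow> c) (approaching S A)"
    and ev: "eventually (\<lambda>s. s \<in> {0<..} - {1 - \<Gamma>}) (at c within T)"
    and phi': "filterlim (\<lambda>s. 3 / (4 * pi) * phi' \<Gamma> s) F (at c within T)"
  shows "filterlim (f_Gamma \<Gamma>) F (approaching S A)"
proof (rule filterlim_cong[OF refl refl, THEN iffD1])
  have mem: "eventually (\<lambda>p. p \<in> S) (approaching S A)"
    by (rule eventually_approaching_mem)
  have s: "filterlim s_fun (at c within T) (approaching S A)"
    unfolding filterlim_at using lim eventually_mono[OF mem S(2)] by simp
  show "filterlim (\<lambda>p. 3 / (4 * pi) * phi' \<Gamma> (s_fun p)) F (approaching S A)"
    by (rule filterlim_compose[OF phi' s])
  have "eventually (\<lambda>p. s_fun p \<in> {0<..} - {1 - \<Gamma>}) (approaching S A)"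
    by (rule eventually_compose_filterlim[OF ev s])
  with mem show "eventually (\<lambda>p. 3 / (4 * pi) * phi' \<Gamma> (s_fun p) = f_Gamma \<Gamma> p) (approaching S A)"
  proof eventually_elim
    case (elim p)
    hence "p \<in> D_set \<Gamma>" using S(1) by blast
    thus ?case using f_Gamma_eq[of p] s_fun_D_set[of p] elim by simp
  qed
qed

text \<open>The side \<open>q_fun\<close> > \<Gamma> corresponds to \<open>s_fun\<close> < 1 -
  \<Gamma>, where the profile has a finite limit; the opposite side meets the blow-up.\<close>

lemma tendsto_f_Gamma_N_down:
  "(f_Gamma \<Gamma> \<longlongrightarrow> 3 / (4 * pi) * (phi'_left (1 - \<Gamma>) / pi\<^sup>2)) (N_down \<Gamma>)"
  unfolding N_down_def
proof (rule filterlim_f_Gamma[where c = "1 - \<Gamma>" and T = "{..<1 - \<Gamma>}"])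
  show "eventually (\<lambda>s. s \<in> {0<..} - {1 - \<Gamma>}) (at_left (1 - \<Gamma>))"
    by (rule eventually_mono[OF eventually_at_left_real[of 0]]) (use Gamma_less in auto)
  show "((\<lambda>s. 3 / (4 * pi) * phi' \<Gamma> s) \<longlongrightarrow> 3 / (4 * pi) * (phi'_left (1 - \<Gamma>) / pi\<^sup>2))
      (at_left (1 - \<Gamma>))"
    by (intro tendsto_mult_left tendsto_phi'_at_left)
qed (auto simp: q_fun_eq intro: tendsto_s_fun_N)

lemma filterlim_f_Gamma_N_up: "filterlim (f_Gamma \<Gamma>) at_top (N_up \<Gamma>)"
  unfolding N_up_def
proof (rule filterlim_f_Gamma[where c = "1 - \<Gamma>" and T = "{1 - \<Gamma><..}"])
  show "eventually (\<lambda>s. s \<in> {0<..} - {1 - \<Gamma>}) (at_right (1 - \<Gamma>))"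
    by (rule eventually_mono[OF eventually_at_right_less]) (use Gamma_less in auto)
  show "filterlim (\<lambda>s. 3 / (4 * pi) * phi' \<Gamma> s) at_top (at_right (1 - \<Gamma>))"
    by (rule filterlim_tendsto_pos_mult_at_top[OF tendsto_const _ filterlim_phi'_at_right]) simp
qed (auto simp: q_fun_eq intro: tendsto_s_fun_N)

lemma filterlim_f_Gamma_M_up: "filterlim (f_Gamma \<Gamma>) at_top (M_up \<Gamma>)"
  unfolding M_up_def
proof (rule filterlim_f_Gamma[where c = 0 and T = "{0<..}"])
  show "eventually (\<lambda>s. s \<in> {0<..} - {1 - \<Gamma>}) (at_right 0)"
    by (rule eventually_mono[OF eventually_at_right_real[of 0 "1 - \<Gamma>"]]) (use Gamma_less in auto)
  show "filterlim (\<lambda>s. 3 / (4 * pi) * phi' \<Gamma> s) at_top (at_right 0)"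
    by (rule filterlim_tendsto_pos_mult_at_top[OF tendsto_const _ filterlim_phi'_at_right_0]) simp
qed (auto simp: q_fun_eq intro: tendsto_s_fun_M)

text \<open>The lower bound on \<open>phi'_left\<close> includes the endpoint 1 - \<Gamma>, which
  makes the limit at \<open>N_set\<close> strictly positive.\<close>

lemma phi'_left_pos: "0 < phi'_left (1 - \<Gamma>)"
proof -
  have "0 < 1 / (2 * sqrt (1 - \<Gamma>))" using Gamma_less by simp
  also have "\<dots> \<le> phi'_left (1 - \<Gamma>)" by (rule phi'_left_ge) (use Gamma_less in auto)
  finally show ?thesis .
qed

end

theorem corollary1p3:
  fixes \<Gamma> :: real
  assumes "\<Gamma> \<in> {1 - 1 / 2 ^ 12..<1}"
  shows "continuous_on (D_set \<Gamma> - (M_set \<Gamma> \<union> N_set \<Gamma>)) (f_Gamma \<Gamma>)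
    \<and> (\<forall>p \<in> D_set \<Gamma> - (M_set \<Gamma> \<union> N_set \<Gamma>). f_Gamma \<Gamma> p > 0)
    \<and> (\<exists>l>0. (f_Gamma \<Gamma> \<longlongrightarrow> l) (N_down \<Gamma>))
    \<and> filterlim (f_Gamma \<Gamma>) at_top (N_up \<Gamma>)
    \<and> filterlim (f_Gamma \<Gamma>) at_top (M_up \<Gamma>)"
proof -
  interpret gamma_near_one \<Gamma>
    by unfold_locales (use assms in auto)
  have "3 / (4 * pi) * (phi'_left (1 - \<Gamma>) / pi\<^sup>2) > 0"
    using phi'_left_pos by simp
  thus ?thesis
    using continuous_on_f_Gamma f_Gamma_pos tendsto_f_Gamma_N_down
      filterlim_f_Gamma_N_up filterlim_f_Gamma_M_up by blast
qed

end
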